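(* Let $N=2\cdot 5^{2a}m^2$ be a friend of $20$, where $a, m$ are positive integers. Then $$\Omega(N)\geq 2\omega(N)+6a-5.$$
   Context: For a positive integer $n$, $\sigma(n)$ denotes the sum of the positive divisors of $n$, and the abundancy index of $n$ is $I(n)=\sigma(n)/n$. A positive integer $N>20$ is called a friend of $20$ if $I(N)=I(20)=21/10$. $\Omega(n)$ denotes the total number of prime divisors of $n$ (counted with multiplicity), and $\omega(n)$ denotes the number of distinct prime divisors of $n$. *)

theory Defs
  imports Complex_Main "HOL-Computational_Algebra.Primes"
begin

definition divisor_sigma :: "nat \<Rightarrow> nat" where
  "divisor_sigma n = (\<Sum>d | d dvd n. d)"

definition abundancy_index :: "nat \<Rightarrow> rat" where
  "abundancy_index n = of_nat (divisor_sigma n) / of_nat n"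

definition friend_of_20 :: "nat \<Rightarrow> bool" where
  "friend_of_20 N \<longleftrightarrow> N > 20 \<and> abundancy_index N = abundancy_index 20"

definition big_omega :: "nat \<Rightarrow> nat" where
  "big_omega n = size (prime_factorization n)"

definition small_omega :: "nat \<Rightarrow> nat" where
  "small_omega n = card (prime_factors n)"

lemma abundancy_index_20: "abundancy_index 20 = 21 / 10"
proof -
  have "{d. d dvd (20::nat)} = Set.filter (\<lambda>d. d dvd 20) {0..20}"
    by (auto dest: dvd_imp_le)
  also have "\<dots> = {1, 2, 4, 5, 10, 20}"
    by code_simp
  finally show ?thesis
    by (simp add: abundancy_index_def divisor_sigma_def)
qed

end

theory Submission
  imports Defs
begin

text \<open>
  If \<open>N = 2 \<cdot> 5\<^sup>2\<^sup>a m\<^sup>2\<close> is a friend of \<open>20\<close>, then \<open>m\<close> is odd, since otherwise \<open>200\<close> divides \<open>N\<close> and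
  already \<open>I(200) > 21/10\<close>. Moving the powers of \<open>5\<close> into \<open>a\<close>, we may assume that \<open>m\<close> is coprime
  to \<open>10\<close>; then \<open>5 \<sigma>(5\<^sup>2\<^sup>a) \<sigma>(m\<^sup>2) = 7 \<cdot> 5\<^sup>2\<^sup>a m\<^sup>2\<close>, so \<open>5\<close> divides \<open>\<sigma>(m\<^sup>2)\<close> at least \<open>2a - 1\<close> times.
  An odd number \<open>n\<close> of terms \<open>1 + q + \<dots> + q\<^sup>n\<^sup>-\<^sup>1\<close> is divisible by \<open>5\<^sup>k\<close> only if \<open>n\<close> is. Hence a prime
  \<open>q\<close> of multiplicity \<open>b\<close> in \<open>m\<close> contributes at most \<open>v\<^sub>5(2b + 1) \<le> b - 1\<close> factors \<open>5\<close>, which gives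
  \<open>2a - 1 \<le> \<Omega>(m) - \<omega>(m)\<close>.
\<close>

section \<open>Multiplicativity and monotonicity of the divisor sum\<close>

lemma divisor_sigma_mult_coprime:
  assumes "coprime a b" "a > 0" "b > 0"
  shows "divisor_sigma (a * b) = divisor_sigma a * divisor_sigma b"
proof -
  let ?D = "\<lambda>n::nat. {d. d dvd n}"
  have inj: "inj_on (\<lambda>(x, y). x * y) (?D a \<times> ?D b)"
  proof (rule inj_onI, clarsimp)
    fix x y x' y' assume d: "x dvd a" "y dvd b" "x' dvd a" "y' dvd b" and e: "x * y = x' * y'"
    have cop: "coprime x y'" "coprime x' y"
      using assms(1) d by (meson coprime_divisors)+
    have "x dvd x' * y'" "x' dvd x * y"
      using e by (metis dvd_triv_left)+
    then have "x = x'"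
      using cop by (meson coprime_dvd_mult_left_iff dvd_antisym)
    moreover have "x > 0"
      using d(1) assms(2) by (auto intro: dvd_pos_nat)
    ultimately show "x = x' \<and> y = y'"
      using e by auto
  qed
  have img: "(\<lambda>(x, y). x * y) ` (?D a \<times> ?D b) = ?D (a * b)"
  proof (intro equalityI subsetI)
    fix d assume "d \<in> ?D (a * b)"
    then obtain x y where "d = x * y" "x dvd a" "y dvd b"
      using division_decomp[of d a b] by auto
    then show "d \<in> (\<lambda>(x, y). x * y) ` (?D a \<times> ?D b)"
      by force
  qed (auto intro: mult_dvd_mono)
  have "divisor_sigma (a * b) = (\<Sum>(x, y)\<in>?D a \<times> ?D b. x * y)"
    unfolding divisor_sigma_def img[symmetric] by (subst sum.reindex[OF inj]) (auto intro: sum.cong)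
  also have "\<dots> = divisor_sigma a * divisor_sigma b"
    by (simp add: divisor_sigma_def sum_product sum.cartesian_product)
  finally show ?thesis .
qed

lemma divisor_sigma_prime_power:
  assumes "prime p"
  shows "divisor_sigma (p ^ k) = (\<Sum>i<Suc k. p ^ i)"
proof -
  have "{d. d dvd p ^ k} = (\<lambda>i. p ^ i) ` {..<Suc k}"
    using assms by (auto simp: divides_primepow_nat less_Suc_eq_le)
  moreover have "inj_on (\<lambda>i. p ^ i) {..<Suc k}"
    using prime_gt_1_nat[OF assms] by (auto intro!: inj_onI)
  ultimately show ?thesis
    by (simp add: divisor_sigma_def sum.reindex del: sum.lessThan_Suc)
qed

lemma divisor_sigma_prod_prime_powers:
  fixes f :: "nat \<Rightarrow> nat"
  assumes "finite P" "\<And>p. p \<in> P \<Longrightarrow> prime p"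
  shows "divisor_sigma (\<Prod>p\<in>P. p ^ f p) = (\<Prod>p\<in>P. divisor_sigma (p ^ f p))"
  using assms
proof (induction P rule: finite_induct)
  case empty
  then show ?case by (simp add: divisor_sigma_def)
next
  case (insert q P)
  have "coprime (q ^ f q) (\<Prod>p\<in>P. p ^ f p)"
    using insert.prems insert.hyps by (intro prod_coprime_right) (auto intro!: primes_coprime)
  moreover have "(\<Prod>p\<in>P. p ^ f p) > 0" "q ^ f q > 0"
    using insert.prems by (auto intro!: prod_pos simp: prime_gt_0_nat)
  ultimately show ?case
    using insert by (simp add: divisor_sigma_mult_coprime)
qed

lemma divisor_sigma_pos: "n > 0 \<Longrightarrow> divisor_sigma n > 0"
  unfolding divisor_sigma_def by (intro sum_pos2[where i = 1]) auto

text \<open>Monotonicity of the abundancy index under divisibility, cleared of denominators: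
  multiplying the divisors of \<open>d\<close> by \<open>n / d\<close> gives distinct divisors of
  \<open>n\<close>.\<close>

lemma divisor_sigma_dvd_mono:
  assumes "d dvd n" "n > 0"
  shows "divisor_sigma d * n \<le> divisor_sigma n * d"
proof -
  obtain k where k: "n = k * d" "k > 0"
    using assms by (auto elim!: dvdE simp: mult.commute)
  have "k * divisor_sigma d = (\<Sum>e\<in>(\<lambda>e. k * e) ` {e. e dvd d}. e)"
    using k(2) by (subst sum.reindex) (auto intro: inj_onI simp: divisor_sigma_def sum_distrib_left)
  also have "\<dots> \<le> divisor_sigma n"
    unfolding divisor_sigma_def using assms k by (intro sum_mono2) auto
  finally show ?thesis
    using k(1) by (simp add: mult.assoc mult.left_commute mult.commute)
qed

section \<open>Powers of 5 in geometric sums\<close>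

lemma geometric_sum_odd_mod_5:
  fixes q :: nat
  assumes "q mod 5 \<noteq> 1"
  shows "(\<Sum>i<Suc (2 * j). q ^ i) mod 5 \<noteq> 0"
proof -
  have step: "(\<Sum>i<Suc (2 * Suc j). q ^ i) = 1 + q + q ^ 2 * (\<Sum>i<Suc (2 * j). q ^ i)" for j
  proof -
    have shift: "(\<Sum>i<Suc n. q ^ i) = 1 + q * (\<Sum>i<n. q ^ i)" for n
      by (subst sum.lessThan_Suc_shift) (simp add: sum_distrib_left)
    have "2 * Suc j = Suc (Suc (2 * j))" by simp
    then show ?thesis
      by (simp only: shift[of "Suc (Suc (2 * j))"] shift[of "Suc (2 * j)"])
        (simp only: algebra_simps power2_eq_square mult_1_right)
  qed
  have r: "q mod 5 \<in> {0, 2, 3, 4}"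
    using assms by (simp, presburger)
  let ?S = "\<lambda>j. (\<Sum>i<Suc (2 * j). q ^ i)"
  \<comment> \<open>The recurrence starts at 1. Modulo 5 it stays there for \<open>q\<close>
    congruent to 0 or 4, and alternates between 1 and \<open>q\<close> for \<open>q\<close>
    congruent to 2 or 3; so it never reaches 0.\<close>
  have "?S j mod 5 \<in> (if q mod 5 \<in> {0, 4} then {1} else {1, q mod 5})"
  proof (induction j)
    case (Suc j)
    have "?S (Suc j) mod 5 = (1 + q mod 5 + (q mod 5) ^ 2 * (?S j mod 5)) mod 5"
      unfolding step by (intro mod_add_cong mod_mult_cong) (simp_all add: power_mod)
    then show ?case
      using Suc r by (auto split: if_splits)
  qed auto
  then show ?thesis
    using r by (auto split: if_splits)
qed

text \<open>Lifting the exponent at 5. Splitting the sum into blocks of five terms factors it as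
  \<open>1 + q + ... + q ^ 4\<close>, which contains exactly one 5, times a sum of
  \<open>n / 5\<close> terms in \<open>q ^ 5\<close>. Induction on \<open>k\<close> therefore needs
  \<open>q\<close> arbitrary.\<close>

lemma power_5_dvd_geometric_sum:
  fixes q :: nat
  assumes "odd n" "5 ^ k dvd (\<Sum>i<n. q ^ i)"
  shows "5 ^ k dvd n"
  using assms
proof (induction k arbitrary: n q)
  case (Suc k)
  have "(\<Sum>i<n. q ^ i) mod 5 = 0"
    using Suc.prems(2) by (auto elim!: dvdE simp: mult.assoc)
  \<comment> \<open>Oddness matters: with an even number of terms, \<open>q\<close> congruent to 4
    would give 0 as well.\<close>
  then have q: "q mod 5 = 1"
    using Suc.prems(1) geometric_sum_odd_mod_5[of q] by (metis oddE Suc_eq_plus1)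
  have "(\<Sum>i<n. q ^ i) mod 5 = (\<Sum>i<n. (q ^ i) mod 5) mod 5"
    by (simp add: mod_sum_eq)
  also have "\<dots> = n mod 5"
    using q by (simp add: power_mod[symmetric, of q])
  finally obtain n' where n': "n = n' * 5"
    using \<open>_ mod 5 = 0\<close> by auto
  obtain t where t: "q = 5 * t + 1"
    using q by (metis mult_div_mod_eq)
  have "(\<Sum>i<n. q ^ i) = (\<Sum>j<n'. \<Sum>i\<in>{j * 5..<j * 5 + 5}. q ^ i)"
    unfolding n' by (rule sum.nat_group[symmetric])
  also have "\<dots> = (\<Sum>j<n'. (q ^ 5) ^ j * (\<Sum>i<5. q ^ i))"
  proof (rule sum.cong[OF refl])
    fix j
    have "(\<Sum>i\<in>{j * 5..<j * 5 + 5}. q ^ i) = (\<Sum>i\<in>{0..<5}. q ^ (i + j * 5))"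
      using sum.shift_bounds_nat_ivl[of "\<lambda>i. q ^ i" 0 "j * 5" 5] by (simp add: add.commute)
    then show "(\<Sum>i\<in>{j * 5..<j * 5 + 5}. q ^ i) = (q ^ 5) ^ j * (\<Sum>i<5. q ^ i)"
      by (simp add: power_add power_mult[symmetric] sum_distrib_right atLeast0LessThan mult.commute)
  qed
  also have "\<dots> = (\<Sum>i<5. q ^ i) * (\<Sum>j<n'. (q ^ 5) ^ j)"
    unfolding sum_distrib_left[of _ _ "{..<n'}"] by (simp only: mult.commute)
  \<comment> \<open>This is the expansion of \<open>((5 * t + 1) ^ 5 - 1) / (5 * t)\<close>. The
    cofactor of 5 is congruent to 1 modulo 5, so only one 5 is lost.\<close>
  also have "(\<Sum>i<5. q ^ i) = 5 * (5 * (2 * t + 10 * t ^ 2 + 25 * t ^ 3 + 25 * t ^ 4) + 1)"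
    unfolding t
    by (simp add: lessThan_nat_numeral power2_eq_square power3_eq_cube power4_eq_xxxx algebra_simps)
  finally have "5 * 5 ^ k dvd
      5 * ((5 * (2 * t + 10 * t ^ 2 + 25 * t ^ 3 + 25 * t ^ 4) + 1) * (\<Sum>j<n'. (q ^ 5) ^ j))"
    using Suc.prems(2) by (simp only: mult.assoc power_Suc)
  then have "5 ^ k dvd
      (5 * (2 * t + 10 * t ^ 2 + 25 * t ^ 3 + 25 * t ^ 4) + 1) * (\<Sum>j<n'. (q ^ 5) ^ j)"
    by (simp only: nat_mult_dvd_cancel1 zero_less_numeral)
  moreover have "coprime (5 ^ k) (5 * u + 1 :: nat)" for u
    using prime_imp_coprime[of 5 "5 * u + 1"] by (simp, presburger)
  ultimately have "5 ^ k dvd (\<Sum>j<n'. (q ^ 5) ^ j)"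
    using coprime_dvd_mult_right_iff by blast
  then show ?case
    using Suc.IH[of n' "q ^ 5"] Suc.prems(1) n' by simp
qed simp

lemma multiplicity_5_divisor_sigma_prime_power:
  assumes "prime q" "b > 0"
  shows "multiplicity 5 (divisor_sigma (q ^ (2 * b))) \<le> b - 1"
proof -
  define k where "k = multiplicity 5 (divisor_sigma (q ^ (2 * b)))"
  have "5 ^ k dvd (\<Sum>i<Suc (2 * b). q ^ i)"
    unfolding k_def divisor_sigma_prime_power[OF assms(1), symmetric] by (rule multiplicity_dvd)
  then have "5 ^ k dvd Suc (2 * b)"
    by (rule power_5_dvd_geometric_sum[rotated]) simp
  then have le: "5 ^ k \<le> Suc (2 * b)"
    by (simp add: dvd_imp_le)
  \<comment> \<open>For positive \<open>k\<close> this yields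
    \<open>2 * k + 3 \<le> 2 * b + 1\<close>, that is \<open>k \<le> b - 1\<close>; equality in the
    exponential bound occurs at \<open>k = 1\<close>.\<close>
  have "k = 0 \<or> 2 * k + 3 \<le> (5::nat) ^ k"
    by (induction k) auto
  then show ?thesis
    using le assms(2) unfolding k_def[symmetric] by auto
qed

lemma size_prime_factorization_eq_sum:
  fixes m :: nat
  shows "size (prime_factorization m) = (\<Sum>p\<in>prime_factors m. multiplicity p m)"
  unfolding size_multiset_overloaded_eq
  by (intro sum.cong) (auto simp: count_prime_factorization in_prime_factors_iff)

text \<open>The 5-adic valuation of the product over prime powers is a sum, in which each prime
  contributes at most its exponent in \<open>m\<close> minus one.\<close>

lemma multiplicity_5_divisor_sigma_square:
  fixes m :: nat
  assumes "m > 0"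
  shows "multiplicity 5 (divisor_sigma (m ^ 2)) + small_omega m \<le> big_omega m"
proof -
  let ?P = "prime_factors m" and ?e = "\<lambda>p. multiplicity p m"
  have m2: "m ^ 2 = (\<Prod>p\<in>?P. p ^ (2 * ?e p))"
  proof -
    have "m = (\<Prod>p\<in>?P. p ^ ?e p)"
      using assms by (simp add: prime_factorization_nat)
    then have "m ^ 2 = (\<Prod>p\<in>?P. p ^ ?e p) ^ 2" by simp
    then show ?thesis
      by (simp add: prod_power_distrib power_mult[symmetric] mult.commute)
  qed
  have "divisor_sigma (m ^ 2) = (\<Prod>p\<in>?P. divisor_sigma (p ^ (2 * ?e p)))"
    unfolding m2 by (rule divisor_sigma_prod_prime_powers) auto
  then have "multiplicity 5 (divisor_sigma (m ^ 2))
      = multiplicity 5 (\<Prod>p\<in>?P. divisor_sigma (p ^ (2 * ?e p)))" by simp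
  also have "\<dots> = (\<Sum>p\<in>?P. multiplicity 5 (divisor_sigma (p ^ (2 * ?e p))))"
  proof (rule prime_elem_multiplicity_prod_distrib)
    have "divisor_sigma (p ^ (2 * ?e p)) > 0" if "p \<in> ?P" for p
      using that by (intro divisor_sigma_pos) (auto simp: in_prime_factors_iff prime_gt_0_nat)
    then show "0 \<notin> (\<lambda>p. divisor_sigma (p ^ (2 * ?e p))) ` ?P" by force
  qed auto
  also have "\<dots> \<le> (\<Sum>p\<in>?P. ?e p - 1)"
    by (intro sum_mono multiplicity_5_divisor_sigma_prime_power) (auto simp: prime_factors_multiplicity)
  finally have "multiplicity 5 (divisor_sigma (m ^ 2)) + small_omega m \<le> (\<Sum>p\<in>?P. (?e p - 1) + 1)"
    by (simp only: sum.distrib small_omega_def card_eq_sum)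
  also have "\<dots> = big_omega m"
    unfolding big_omega_def size_prime_factorization_eq_sum
    by (intro sum.cong) (auto simp: prime_factors_multiplicity)
  finally show ?thesis .
qed

section \<open>Friends of 20\<close>

lemma friend_of_20_sigma:
  assumes "friend_of_20 N"
  shows "10 * divisor_sigma N = 21 * N"
proof -
  have "N > 0" "(of_nat (divisor_sigma N) :: rat) / of_nat N = 21 / 10"
    using assms by (auto simp: friend_of_20_def abundancy_index_20 abundancy_index_def[of N])
  then have "(of_nat (10 * divisor_sigma N) :: rat) = of_nat (21 * N)"
    by (simp add: field_simps)
  then show ?thesis
    by (simp only: of_nat_eq_iff)
qed

lemma divisor_sigma_200: "divisor_sigma 200 = 465"
proof -
  have "divisor_sigma (2 ^ 3) = 15" "divisor_sigma (5 ^ 2) = 31"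
    by (subst divisor_sigma_prime_power; simp add: lessThan_nat_numeral)+
  moreover have "coprime (2 ^ 3) (5 ^ 2 :: nat)"
    by (intro coprime_power_left_iff[THEN iffD2] coprime_power_right_iff[THEN iffD2] disjI1)
      (simp add: primes_coprime)
  ultimately show ?thesis
    using divisor_sigma_mult_coprime[of "2 ^ 3" "5 ^ 2"] by simp
qed

text \<open>The index of 200 is 465/200, above 21/10 = 420/200, and the index cannot drop when
  passing to a multiple.\<close>

lemma friend_of_20_not_dvd_200:
  assumes "friend_of_20 N"
  shows "\<not> 200 dvd N"
proof
  assume "200 dvd N"
  moreover have "N > 0"
    using assms by (simp add: friend_of_20_def)
  ultimately show False
    using divisor_sigma_dvd_mono[of 200 N] friend_of_20_sigma[OF assms] divisor_sigma_200 by simp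
qed

lemma friend_of_20_coprime_case:
  fixes a m :: nat
  assumes "a > 0" "m > 0" "coprime m 2" "coprime m 5"
    and "friend_of_20 (2 * 5 ^ (2 * a) * m ^ 2)"
  shows "2 * small_omega (2 * 5 ^ (2 * a) * m ^ 2) + 6 * a \<le> big_omega (2 * 5 ^ (2 * a) * m ^ 2) + 5"
proof -
  let ?N = "2 * 5 ^ (2 * a) * m ^ 2" and ?A = "divisor_sigma (5 ^ (2 * a))"
    and ?M = "divisor_sigma (m ^ 2)"
  have p5: "prime (5::nat)" by simp
  have c25: "coprime (2::nat) (5 ^ (2 * a))"
    by (auto intro!: primes_coprime)
  have "coprime (2 * 5 ^ (2 * a)) (m ^ 2)"
    using assms(3,4) by (simp add: coprime_commute)
  then have "divisor_sigma ?N = divisor_sigma (2 ^ 1) * ?A * ?M"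
    using c25 assms(2) by (simp add: divisor_sigma_mult_coprime)
  also have "divisor_sigma (2 ^ 1) = 3"
    by (subst divisor_sigma_prime_power) auto
  finally have "5 * (?A * ?M) = 7 * 5 ^ (2 * a) * m ^ 2"
    using friend_of_20_sigma[OF assms(5)] by (simp add: mult_ac)
  also have "\<dots> = 5 * (5 ^ (2 * a - 1) * (7 * m ^ 2))"
    using assms(1) power_Suc[of "5::nat" "2 * a - 1"] by simp
  finally have "?A * ?M = 5 ^ (2 * a - 1) * (7 * m ^ 2)"
    by (simp add: mult_ac)
  then have "5 ^ (2 * a - 1) dvd ?A * ?M"
    by simp
  \<comment> \<open>Every term of \<open>?A\<close> except the leading 1 is a multiple of 5, so all
    the factors 5 must come from \<open>?M\<close>.\<close>
  moreover have "coprime (5 ^ (2 * a - 1)) ?A"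
  proof -
    have "?A mod 5 \<noteq> 0"
      using geometric_sum_odd_mod_5[of 5 a] divisor_sigma_prime_power[OF p5, of "2 * a"] by simp
    then show ?thesis
      using p5 by (simp add: prime_imp_coprime dvd_eq_mod_eq_0)
  qed
  ultimately have "5 ^ (2 * a - 1) dvd ?M"
    using coprime_dvd_mult_right_iff by blast
  moreover have "?M > 0"
    using assms(2) by (intro divisor_sigma_pos) simp
  ultimately have "2 * a - 1 \<le> multiplicity 5 ?M"
    by (intro multiplicity_geI) auto
  then have key: "2 * a - 1 + small_omega m \<le> big_omega m"
    using multiplicity_5_divisor_sigma_square[OF assms(2)] by linarith
  have fac: "prime_factorization ?N =
      {#2#} + replicate_mset (2 * a) 5 + (prime_factorization m + prime_factorization m)"
    using assms(2) p5
    by (simp add: prime_factorization_mult prime_factorization_prime_power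
        prime_factorization_prime power2_eq_square)
  have "big_omega ?N = 1 + 2 * a + 2 * big_omega m"
    unfolding big_omega_def fac by simp
  moreover have "small_omega ?N \<le> 2 + small_omega m"
  proof -
    have "prime_factors ?N = insert 2 (insert 5 (prime_factors m))"
      unfolding fac using assms(1) by auto
    then show ?thesis
      unfolding small_omega_def by (simp add: card_insert_if)
  qed
  \<comment> \<open>Doubling \<open>key\<close> gives \<open>big_omega ?N\<close> at least
    \<open>1 + 2 * a + 2 * (2 * a - 1 + small_omega m)\<close>; the primes 2 and 5 account for the
    remaining loss of 4.\<close>
  ultimately show ?thesis
    using key assms(1) by linarith
qed

theorem theorem2:
  fixes N a m :: nat
  assumes "a > 0" and "m > 0"
    and "N = 2 * 5 ^ (2 * a) * m ^ 2"
    and "friend_of_20 N"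
  shows "int (big_omega N) \<ge> 2 * int (small_omega N) + 6 * int a - 5"
proof -
  have "odd m"
  proof
    assume "even m"
    then have "2 ^ 2 dvd m ^ 2"
      by (rule dvd_power_same)
    moreover have "5 ^ 2 dvd (5::nat) ^ (2 * a)"
      using assms(1) by (intro le_imp_power_dvd) simp
    \<comment> \<open>The product on the left is 200.\<close>
    ultimately have "2 * 5 ^ 2 * 2 ^ 2 dvd N"
      unfolding assms(3) by (intro mult_dvd_mono) auto
    then show False
      using friend_of_20_not_dvd_200[OF assms(4)] by simp
  qed
  define c where "c = multiplicity 5 m"
  obtain l where m: "m = 5 ^ c * l" "\<not> 5 dvd l"
    unfolding c_def by (rule multiplicity_decompose'[of m 5]) (use assms(2) in auto)
  have N: "N = 2 * 5 ^ (2 * (a + c)) * l ^ 2"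
    unfolding assms(3) m(1) by (simp add: power_mult_distrib power_add power_mult[symmetric] algebra_simps)
  have "coprime l 5"
    using m(2) prime_imp_coprime[of 5 l] by (simp add: coprime_commute)
  moreover have "coprime l 2" "l > 0"
    using \<open>odd m\<close> m(1) by (auto intro!: Nat.gr0I)
  ultimately have "2 * small_omega N + 6 * (a + c) \<le> big_omega N + 5"
    using friend_of_20_coprime_case[of "a + c" l] assms(1,4) unfolding N by simp
  \<comment> \<open>Moving \<open>c\<close> into the exponent of 5 only strengthened the
    bound.\<close>
  then have "2 * small_omega N + 6 * a \<le> big_omega N + 5"
    by simp
  then show ?thesis
    by linarith
qed

end
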